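(* For every positive integer $k$, there is a real number $L>0$ such that \[\lim_{n\to\infty}\frac{\tilde{r}(K_{1,k},P_n)}{n}=L=\lim_{n\to\infty}\frac{\tilde{r}(K_{1,k},C_n)}{n}.\]
   Context: For finite graphs $G$ and $H$, the online Ramsey game is played by Builder and Painter on the infinite complete graph $K_{\mathbb{N}}$ with vertex set $\mathbb{N}$. In each round Builder chooses an edge of $K_{\mathbb{N}}$ and Painter immediately and irrevocably colors it red or blue. (Builder may re-choose an already chosen edge, which keeps its color; this gives Builder no advantage.) The online Ramsey number $\tilde{r}(G,H)$ is the smallest integer $t$ for which Builder has a strategy that guarantees, regardless of Painter's choices, a red copy of $G$ or a blue copy of $H$ (as a not necessarily induced subgraph) within at most $t$ rounds. $P_n$ denotes the path on $n$ vertices, $C_n$ ($n\ge 3$) the cycle on $n$ vertices, and $K_{1,k}$ the star with $k$ edges. *)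

theory Defs
  imports Complex_Main "HOL-Library.Ramsey"
begin

text \<open>Simple graphs: edges are two-element sets of vertices.\<close>

record 'a ugraph =
  verts :: "'a set"
  edges :: "'a set set"

definition path_graph :: "nat \<Rightarrow> nat ugraph" where
  "path_graph n = \<lparr>verts = {..<n}, edges = {{i, Suc i} | i. Suc i < n}\<rparr>"

text \<open>This is the cycle on \<open>n\<close> vertices only for \<open>n \<ge> 3\<close>.\<close>

definition cycle_graph :: "nat \<Rightarrow> nat ugraph" where
  "cycle_graph n = \<lparr>verts = {..<n}, edges = {{i, Suc i mod n} | i. i < n}\<rparr>"

definition star_graph :: "nat \<Rightarrow> nat ugraph" where
  "star_graph k = \<lparr>verts = {0..k}, edges = {{0, i} | i. i \<in> {1..k}}\<rparr>"

text \<open>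
  The host is a set \<open>E\<close> of edges of the complete graph on the natural numbers, all of which are
  available as vertices. Copies need not be induced.
\<close>

definition has_copy :: "'a ugraph \<Rightarrow> nat set set \<Rightarrow> bool" where
  "has_copy G E \<longleftrightarrow> (\<exists>f. inj_on f (verts G) \<and> (\<forall>e\<in>edges G. f ` e \<in> E))"

datatype colour = Red | Blue

text \<open>A history lists the rounds played so far, in chronological order.\<close>

type_synonym history = "(nat set \<times> colour) list"

definition coloured_edges :: "colour \<Rightarrow> history \<Rightarrow> nat set set" where
  "coloured_edges c h = {e. (e, c) \<in> set h}"

type_synonym builder_strategy = "history \<Rightarrow> nat set"

text \<open>\<open>nsets UNIV 2\<close> is the edge set of the complete graph on the natural numbers.\<close>

definition legal_strategy :: "builder_strategy \<Rightarrow> bool" where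
  "legal_strategy \<sigma> \<longleftrightarrow> (\<forall>h. \<sigma> h \<in> nsets UNIV 2)"

text \<open>
  The histories that can arise when Builder follows \<open>\<sigma>\<close>: Painter's colours are arbitrary, except
  that an edge chosen again keeps its colour.
\<close>

definition play_of :: "builder_strategy \<Rightarrow> history \<Rightarrow> bool" where
  "play_of \<sigma> h \<longleftrightarrow>
     (\<forall>i<length h. fst (h ! i) = \<sigma> (take i h)) \<and>
     (\<forall>i<length h. \<forall>j<length h. fst (h ! i) = fst (h ! j) \<longrightarrow> snd (h ! i) = snd (h ! j))"

definition builder_goal :: "'a ugraph \<Rightarrow> 'b ugraph \<Rightarrow> history \<Rightarrow> bool" where
  "builder_goal G H h \<longleftrightarrow>
     has_copy G (coloured_edges Red h) \<or> has_copy H (coloured_edges Blue h)"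

definition builder_wins_within :: "'a ugraph \<Rightarrow> 'b ugraph \<Rightarrow> nat \<Rightarrow> bool" where
  "builder_wins_within G H t \<longleftrightarrow>
     (\<exists>\<sigma>. legal_strategy \<sigma> \<and>
       (\<forall>h. play_of \<sigma> h \<and> length h = t \<longrightarrow> (\<exists>s\<le>t. builder_goal G H (take s h))))"

text \<open>For finite \<open>G\<close> and \<open>H\<close> a suitable \<open>t\<close> exists by Ramsey's theorem.\<close>

definition online_ramsey :: "'a ugraph \<Rightarrow> 'b ugraph \<Rightarrow> nat" where
  "online_ramsey G H = (LEAST t. builder_wins_within G H t)"

end

theory Submission
  imports Defs
begin

text \<open>
  Write \<open>r n\<close> and \<open>c n\<close> for the online Ramsey numbers of the star with \<open>k\<close> edges against the path
  and against the cycle on \<open>n\<close> vertices. Everything rests on one cheap gadget. Given two vertices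
  \<open>x\<close> and \<open>y\<close>, Builder takes \<open>2k\<close> new vertices and asks for all edges from \<open>x\<close> and from \<open>y\<close> to
  them. Unless a red star appears, each of \<open>x\<close> and \<open>y\<close> has at most \<open>k - 1\<close> red edges to the new
  vertices, so some new vertex is joined to both of them in blue
  (\<open>forces_common_blue_neighbour\<close>). The cost is \<open>4k\<close> rounds, whatever has been played before, and
  the gadget adds exactly one vertex to a blue path.

  Applied to an end of each of two disjoint blue paths, it gives
  \<open>r (m + n + 1) \<le> r m + r n + 4k\<close> for \<open>m, n \<ge> 1\<close> (\<open>forces_path_joined\<close>). Hence \<open>f n = r (n - 1) + 4k\<close> is
  subadditive, and by Fekete's lemma \<open>f n / n\<close> converges. Applied to the two ends of a single
  blue path, it closes the path to a cycle of exactly the required length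
  (\<open>forces_cycle_closed\<close>), so \<open>c n \<le> r (n - 1) + 4k = f n\<close>. A cycle contains a path on
  the same vertices, so \<open>f n - 4k = r (n - 1) \<le> r n \<le> c n \<le> f n\<close> for \<open>n \<ge> 2\<close>, and both quotients have the
  limit of \<open>f n / n\<close>. The limit is at least \<open>1\<close>: if Painter always answers blue, Builder
  needs \<open>n - 1\<close> rounds to get a blue path on \<open>n\<close> vertices (\<open>forces_path_length_le\<close>).

  Strategies as functions of the history are awkward to compose. The predicate \<open>forces\<close> describes
  instead, by recursion on the number of rounds left, from which positions Builder can reach a
  given aim; consecutive plans then compose by \<open>forces_trans\<close>. For winning from the empty
  position the two descriptions agree (\<open>builder_wins_within_iff_forces\<close>).
\<close>

section \<open>Positions and what Builder can force\<close>

text \<open>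
  A position is given by its red and blue edge sets \<open>R\<close> and \<open>B\<close>. The guards \<open>e \<notin> B\<close> and
  \<open>e \<notin> R\<close> encode that an edge chosen again keeps its colour: on a red edge Painter's answer blue
  is impossible, and the answer red leaves the position unchanged.
\<close>

primrec forces ::
  "(nat set set \<Rightarrow> nat set set \<Rightarrow> bool) \<Rightarrow> nat \<Rightarrow> nat set set \<Rightarrow> nat set set \<Rightarrow> bool"
where
  "forces Q 0 R B \<longleftrightarrow> Q R B"
| "forces Q (Suc t) R B \<longleftrightarrow> Q R B \<or>
     (\<exists>e\<in>nsets UNIV 2. (e \<notin> B \<longrightarrow> forces Q t (insert e R) B) \<and> (e \<notin> R \<longrightarrow> forces Q t R (insert e B)))"

lemma forces_done: "Q R B \<Longrightarrow> forces Q t R B"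
  by (cases t) auto

lemma forces_more_time: "forces Q s R B \<Longrightarrow> s \<le> t \<Longrightarrow> forces Q t R B"
proof (induction s arbitrary: t R B)
  case 0
  then show ?case by (simp add: forces_done)
next
  case (Suc s)
  then obtain t' where "t = Suc t'" "s \<le> t'" by (cases t) auto
  with Suc show ?case by fastforce
qed

text \<open>
  Sequential composition of plans. The second plan may depend on the position reached by the first,
  and may rely on no edge having been lost.
\<close>

lemma forces_trans:
  assumes "forces Q s R B"
    and "\<And>R' B'. \<lbrakk>Q R' B'; R \<subseteq> R'; B \<subseteq> B'\<rbrakk> \<Longrightarrow> forces Q' t R' B'"
  shows "forces Q' (s + t) R B"
  using assms
proof (induction s arbitrary: R B)
  case 0
  then show ?case by simp
next
  case (Suc s)
  show ?case
  proof (cases "Q R B")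
    case True
    then have "forces Q' t R B" using Suc.prems(2) by simp
    then show ?thesis by (rule forces_more_time) simp
  next
    case False
    then obtain e where e: "e \<in> nsets UNIV 2"
        "e \<notin> B \<Longrightarrow> forces Q s (insert e R) B" "e \<notin> R \<Longrightarrow> forces Q s R (insert e B)"
      using Suc.prems(1) by auto
    have "forces Q' (s + t) (insert e R) B" if "e \<notin> B"
      using Suc.IH[OF e(2)[OF that]] Suc.prems(2) by simp
    moreover have "forces Q' (s + t) R (insert e B)" if "e \<notin> R"
      using Suc.IH[OF e(3)[OF that]] Suc.prems(2) by simp
    ultimately show ?thesis using e(1) by auto
  qed
qed

text \<open>
  Builder can carry a plan for the position \<open>(R1, B1)\<close> over to other vertices, in the presence of
  arbitrary old edges \<open>R\<close> and \<open>B\<close>. Old edges among the new vertices do no harm: a forced answer only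
  removes choices from Painter, and it is one of the answers for which the plan is prepared.
\<close>

lemma forces_relabelled:
  assumes "inj \<phi>" and "forces Q t R1 B1"
  shows "forces (\<lambda>R' B'. \<exists>R2 B2. R' = R \<union> (`) \<phi> ` R2 \<and> B' = B \<union> (`) \<phi> ` B2 \<and> Q R2 B2) t
           (R \<union> (`) \<phi> ` R1) (B \<union> (`) \<phi> ` B1)"
  using assms(2)
proof (induction t arbitrary: R1 B1)
  case 0
  then show ?case by auto
next
  case (Suc t)
  let ?Q = "\<lambda>R' B'. \<exists>R2 B2. R' = R \<union> (`) \<phi> ` R2 \<and> B' = B \<union> (`) \<phi> ` B2 \<and> Q R2 B2"
  show ?case
  proof (cases "Q R1 B1")
    case True
    then show ?thesis by (intro forces_done) blast
  next
    case False
    then obtain e where e: "e \<in> nsets UNIV 2"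
        "e \<notin> B1 \<Longrightarrow> forces Q t (insert e R1) B1" "e \<notin> R1 \<Longrightarrow> forces Q t R1 (insert e B1)"
      using Suc.prems by auto
    have "\<phi> ` e \<in> nsets UNIV 2"
      using e(1) assms(1) by (auto simp: nsets_def card_image inj_on_subset)
    moreover have "forces ?Q t (insert (\<phi> ` e) (R \<union> (`) \<phi> ` R1)) (B \<union> (`) \<phi> ` B1)"
      if "\<phi> ` e \<notin> B \<union> (`) \<phi> ` B1"
    proof -
      have "e \<notin> B1" using that by auto
      from Suc.IH[OF e(2)[OF this]] show ?thesis by simp
    qed
    moreover have "forces ?Q t (R \<union> (`) \<phi> ` R1) (insert (\<phi> ` e) (B \<union> (`) \<phi> ` B1))"
      if "\<phi> ` e \<notin> R \<union> (`) \<phi> ` R1"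
    proof -
      have "e \<notin> R1" using that by auto
      from Suc.IH[OF e(3)[OF this]] show ?thesis by simp
    qed
    ultimately show ?thesis
      unfolding forces.simps by (intro disjI2 bexI[of _ "\<phi> ` e"] conjI impI)
  qed
qed

lemma forces_all_coloured:
  assumes "finite F" and "F \<subseteq> nsets UNIV 2"
  shows "forces (\<lambda>R' B'. R \<subseteq> R' \<and> B \<subseteq> B' \<and> F \<subseteq> R' \<union> B') (card F) R B"
  using assms
proof (induction F arbitrary: R B rule: finite_induct)
  case empty
  then show ?case by simp
next
  case (insert e F)
  let ?Q = "\<lambda>R B R' B'. R \<subseteq> R' \<and> B \<subseteq> B' \<and> F \<subseteq> R' \<union> B'"
  let ?Q' = "\<lambda>R' B'. R \<subseteq> R' \<and> B \<subseteq> B' \<and> insert e F \<subseteq> R' \<union> B'"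
  have IH: "forces (?Q R B) (card F) R B" for R B
    using insert by auto
  have "forces ?Q' (card F + 0) (insert e R) B"
    by (rule forces_trans[OF IH]) auto
  moreover have "forces ?Q' (card F + 0) R (insert e B)"
    by (rule forces_trans[OF IH]) auto
  ultimately show ?case using insert by (auto simp: card_insert_if)
qed

section \<open>Forcing and strategies\<close>

lemma has_copy_mono: "has_copy G E \<Longrightarrow> E \<subseteq> E' \<Longrightarrow> has_copy G E'"
  unfolding has_copy_def by blast

lemma coloured_edges_snoc [simp]:
  "coloured_edges c (h @ [(e, d)]) =
     (if c = d then insert e (coloured_edges c h) else coloured_edges c h)"
  by (auto simp: coloured_edges_def)

lemma coloured_edges_Nil [simp]: "coloured_edges c [] = {}"
  by (simp add: coloured_edges_def)

text \<open>
  Turns the consistency condition on a whole history into a condition on the last round only, which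
  is what the guards in \<open>forces\<close> speak about.
\<close>

lemma play_of_snoc:
  "play_of \<sigma> (h @ [(e, c)]) \<longleftrightarrow>
     play_of \<sigma> h \<and> e = \<sigma> h \<and> (\<forall>d. e \<in> coloured_edges d h \<longrightarrow> d = c)"
proof -
  have conv: "play_of \<sigma> h \<longleftrightarrow> (\<forall>i<length h. fst (h ! i) = \<sigma> (take i h)) \<and>
      (\<forall>p\<in>set h. \<forall>q\<in>set h. fst p = fst q \<longrightarrow> snd p = snd q)" for h
    unfolding play_of_def all_set_conv_all_nth ..
  have new: "(\<forall>d. e \<in> coloured_edges d h \<longrightarrow> d = c) \<longleftrightarrow> (\<forall>q\<in>set h. fst q = e \<longrightarrow> snd q = c)"
    by (auto simp: coloured_edges_def)
  have sym: "(\<forall>q\<in>set h. e = fst q \<longrightarrow> c = snd q) \<longleftrightarrow> (\<forall>q\<in>set h. fst q = e \<longrightarrow> snd q = c)"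
    by (simp only: eq_commute)
  have "(\<forall>i<length (h @ [(e, c)]). fst ((h @ [(e, c)]) ! i) = \<sigma> (take i (h @ [(e, c)]))) \<longleftrightarrow>
      (\<forall>i<length h. fst (h ! i) = \<sigma> (take i h)) \<and> e = \<sigma> h"
    by (simp add: All_less_Suc nth_append conj_commute)
  moreover have "(\<forall>p\<in>set (h @ [(e, c)]). \<forall>q\<in>set (h @ [(e, c)]). fst p = fst q \<longrightarrow> snd p = snd q) \<longleftrightarrow>
      (\<forall>p\<in>set h. \<forall>q\<in>set h. fst p = fst q \<longrightarrow> snd p = snd q) \<and>
      (\<forall>q\<in>set h. fst q = e \<longrightarrow> snd q = c)"
    using sym by (simp add: ball_Un ball_conj_distrib conj_ac)
  ultimately show ?thesis
    unfolding conv[of h] conv[of "h @ [(e, c)]"] new by (simp only: conj_ac)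
qed

definition goal :: "'a ugraph \<Rightarrow> 'b ugraph \<Rightarrow> nat set set \<Rightarrow> nat set set \<Rightarrow> bool" where
  "goal G H R B \<longleftrightarrow> has_copy G R \<or> has_copy H B"

lemma goal_mono: "goal G H R B \<Longrightarrow> R \<subseteq> R' \<Longrightarrow> B \<subseteq> B' \<Longrightarrow> goal G H R' B'"
  unfolding goal_def by (auto intro: has_copy_mono)

text \<open>
  Backward induction along the plays of the strategy: with \<open>d\<close> rounds left Builder's move is the one
  the strategy prescribes for the current history.
\<close>

lemma builder_wins_within_imp_forces:
  assumes "builder_wins_within G H t"
  shows "forces (goal G H) t {} {}"
proof -
  obtain \<sigma> where legal: "legal_strategy \<sigma>"
    and win: "\<And>h. play_of \<sigma> h \<Longrightarrow> length h = t \<Longrightarrow> \<exists>s\<le>t. builder_goal G H (take s h)"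
    using assms unfolding builder_wins_within_def by blast
  have "forces (goal G H) d (coloured_edges Red h) (coloured_edges Blue h)"
    if "play_of \<sigma> h" "length h + d = t" for d h
    using that
  proof (induction d arbitrary: h)
    case 0
    then obtain s where "builder_goal G H (take s h)" using win by auto
    then have "goal G H (coloured_edges Red (take s h)) (coloured_edges Blue (take s h))"
      by (simp add: builder_goal_def goal_def)
    moreover have "coloured_edges c (take s h) \<subseteq> coloured_edges c h" for c
      unfolding coloured_edges_def using set_take_subset by fast
    ultimately have "goal G H (coloured_edges Red h) (coloured_edges Blue h)"
      using goal_mono by metis
    then show ?case by simp
  next
    case (Suc d)
    let ?e = "\<sigma> h"
    have branch: "forces (goal G H) d (coloured_edges Red (h @ [(?e, c)]))
        (coloured_edges Blue (h @ [(?e, c)]))" if "\<forall>d. d \<noteq> c \<longrightarrow> ?e \<notin> coloured_edges d h" for c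
      using that Suc by (intro Suc.IH) (auto simp: play_of_snoc)
    have "?e \<in> nsets UNIV 2" using legal by (simp add: legal_strategy_def)
    moreover have "forces (goal G H) d (insert ?e (coloured_edges Red h)) (coloured_edges Blue h)"
      if "?e \<notin> coloured_edges Blue h"
    proof -
      have "\<forall>d. d \<noteq> Red \<longrightarrow> ?e \<notin> coloured_edges d h"
        using that by (metis colour.exhaust)
      from branch[OF this] show ?thesis by simp
    qed
    moreover have "forces (goal G H) d (coloured_edges Red h) (insert ?e (coloured_edges Blue h))"
      if "?e \<notin> coloured_edges Red h"
    proof -
      have "\<forall>d. d \<noteq> Blue \<longrightarrow> ?e \<notin> coloured_edges d h"
        using that by (metis colour.exhaust)
      from branch[OF this] show ?thesis by simp
    qed
    ultimately show ?case by auto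
  qed
  from this[of "[]" t] show ?thesis by (simp add: play_of_def)
qed

text \<open>
  The strategy picks at each history some move that keeps the aim within reach of the rounds left.
  Along every play, reachability of the aim in the remaining time is then an invariant, and with no
  round left it says that the aim is attained.
\<close>

lemma forces_imp_builder_wins_within:
  assumes "forces (goal G H) t {} {}"
  shows "builder_wins_within G H t"
proof -
  let ?R = "coloured_edges Red" and ?B = "coloured_edges Blue"
  define good where "good h e \<longleftrightarrow> e \<in> nsets UNIV 2 \<and>
      (e \<notin> ?B h \<longrightarrow> forces (goal G H) (t - Suc (length h)) (insert e (?R h)) (?B h)) \<and>
      (e \<notin> ?R h \<longrightarrow> forces (goal G H) (t - Suc (length h)) (?R h) (insert e (?B h)))" for h e
  \<comment> \<open>The edge \<open>{0, 1}\<close> is a dummy that keeps the strategy legal when no good move exists, for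
    instance after the time is over.\<close>
  define \<sigma> where "\<sigma> h = (if \<exists>e. good h e then SOME e. good h e else {0, 1})" for h
  have good: "good h (\<sigma> h)" if "good h e" for h e
    using that unfolding \<sigma>_def by (metis someI_ex)
  have "legal_strategy \<sigma>"
    unfolding legal_strategy_def
  proof
    fix h
    show "\<sigma> h \<in> nsets UNIV 2"
    proof (cases "\<exists>e. good h e")
      case True
      then show ?thesis using good good_def by blast
    next
      case False
      then show ?thesis by (simp add: \<sigma>_def nsets_def)
    qed
  qed
  moreover have inv: "forces (goal G H) (t - length h) (?R h) (?B h)"
    if "play_of \<sigma> h" "length h \<le> t" for h
    using that
  proof (induction h rule: rev_induct)
    case Nil
    then show ?case using assms by simp
  next
    case (snoc p h)
    obtain e c where p: "p = (e, c)" by fastforce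
    from snoc.prems have h: "play_of \<sigma> h" "e = \<sigma> h" "\<And>d. e \<in> coloured_edges d h \<Longrightarrow> d = c"
      unfolding p play_of_snoc by auto
    have IH: "forces (goal G H) (t - length h) (?R h) (?B h)"
      using snoc h(1) by simp
    show ?case
    proof (cases "goal G H (?R h) (?B h)")
      case True
      then have "goal G H (?R (h @ [p])) (?B (h @ [p]))"
        by (rule goal_mono) (auto simp: coloured_edges_def)
      then show ?thesis by (rule forces_done)
    next
      case False
      have "t - length h = Suc (t - Suc (length h))" using snoc.prems by simp
      with IH False obtain e' where "good h e'"
        unfolding good_def by auto
      then have "good h e" using good h(2) by blast
      then show ?thesis
        using h(3) unfolding good_def p by (cases c) auto
    qed
  qed
  have "builder_goal G H (take t h)" if "play_of \<sigma> h" "length h = t" for h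
    using inv[OF that(1)] that(2) by (simp add: builder_goal_def goal_def)
  ultimately show ?thesis unfolding builder_wins_within_def by blast
qed

lemma builder_wins_within_iff_forces:
  "builder_wins_within G H t \<longleftrightarrow> forces (goal G H) t {} {}"
  using builder_wins_within_imp_forces forces_imp_builder_wins_within by blast

lemma online_ramsey_le: "forces (goal G H) t {} {} \<Longrightarrow> online_ramsey G H \<le> t"
  unfolding online_ramsey_def builder_wins_within_iff_forces by (rule Least_le)

lemma forces_online_ramsey:
  "forces (goal G H) t {} {} \<Longrightarrow> forces (goal G H) (online_ramsey G H) {} {}"
  unfolding online_ramsey_def builder_wins_within_iff_forces by (rule LeastI)

section \<open>Copies of stars, paths and cycles\<close>

lemma has_copy_path_graph:
  "has_copy (path_graph n) E \<longleftrightarrow>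
     (\<exists>f. inj_on f {..<n} \<and> (\<forall>i. Suc i < n \<longrightarrow> {f i, f (Suc i)} \<in> E))"
  unfolding has_copy_def path_graph_def by (auto simp: setcompr_eq_image)

lemma has_copy_relabelled:
  assumes "inj \<phi>" "has_copy G E"
  shows "has_copy G ((`) \<phi> ` E)"
proof -
  obtain f where "inj_on f (verts G)" "\<forall>e\<in>edges G. f ` e \<in> E"
    using assms(2) unfolding has_copy_def by blast
  then have "inj_on (\<phi> \<circ> f) (verts G)" "\<forall>e\<in>edges G. (\<phi> \<circ> f) ` e \<in> (`) \<phi> ` E"
    using assms(1) by (auto simp: comp_inj_on inj_on_subset image_comp[symmetric])
  then show ?thesis unfolding has_copy_def by blast
qed

lemma has_copy_star_graph:
  assumes "x \<notin> W" "finite W" "card W = k" "\<And>w. w \<in> W \<Longrightarrow> {x, w} \<in> E"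
  shows "has_copy (star_graph k) E"
proof -
  obtain g where g: "bij_betw g {1..k} W"
    using finite_same_card_bij[of "{1..k}" W] assms(2,3) by auto
  let ?f = "\<lambda>i. if i = 0 then x else g i"
  have g_in: "g i \<in> W" if "i \<in> {1..k}" for i
    using g that by (rule bij_betw_apply)
  have "inj_on ?f {0..k}"
  proof (rule linorder_inj_onI)
    fix i j assume "i < j" "i \<in> {0..k}" "j \<in> {0..k}"
    then show "?f i \<noteq> ?f j"
      using g_in[of j] assms(1) bij_betw_imp_inj_on[OF g] by (auto simp: inj_on_eq_iff)
  qed auto
  moreover have "?f ` e \<in> E" if e: "e \<in> edges (star_graph k)" for e
  proof -
    obtain i where i: "e = {0, i}" "i \<in> {1..k}"
      using e unfolding star_graph_def by auto
    then have "?f ` e = {x, g i}" by auto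
    then show ?thesis using g_in[OF i(2)] assms(4) by simp
  qed
  moreover have "verts (star_graph k) = {0..k}" by (simp add: star_graph_def)
  ultimately show ?thesis unfolding has_copy_def by metis
qed

lemma has_copy_path_shorter:
  "has_copy (path_graph n) E \<Longrightarrow> m \<le> n \<Longrightarrow> has_copy (path_graph m) E"
  unfolding has_copy_path_graph by (meson inj_on_subset lessThan_subset_iff less_le_trans)

lemma has_copy_cycle_imp_path:
  assumes "has_copy (cycle_graph n) E"
  shows "has_copy (path_graph n) E"
proof -
  obtain f where "inj_on f {..<n}" and f: "\<forall>e\<in>edges (cycle_graph n). f ` e \<in> E"
    using assms unfolding has_copy_def cycle_graph_def by auto
  moreover have "{f i, f (Suc i)} \<in> E" if "Suc i < n" for i
  proof -
    have "{i, Suc i} \<in> edges (cycle_graph n)"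
      using that unfolding cycle_graph_def by (auto intro!: exI[of _ i])
    with f show ?thesis by fastforce
  qed
  ultimately show ?thesis unfolding has_copy_path_graph by blast
qed

lemma has_copy_path_joined:
  assumes f: "inj_on f {..<m}" "\<And>i. Suc i < m \<Longrightarrow> {f i, f (Suc i)} \<in> E"
    and g: "inj_on g {..<n}" "\<And>i. Suc i < n \<Longrightarrow> {g i, g (Suc i)} \<in> E"
    and disj: "f ` {..<m} \<inter> g ` {..<n} = {}" "w \<notin> f ` {..<m} \<union> g ` {..<n}"
    and w: "{f (m - 1), w} \<in> E" "{g 0, w} \<in> E"
  shows "has_copy (path_graph (m + n + 1)) E"
proof -
  let ?h = "\<lambda>i. if i < m then f i else if i = m then w else g (i - Suc m)"
  have "?h i \<noteq> ?h j" if "i < j" "j < m + n + 1" for i j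
  proof -
    consider "j < m" | "i < m" "j = m" | "i < m" "m < j" | "i = m" | "m < i"
      using that by linarith
    then show ?thesis
    proof cases
      case 1
      then show ?thesis using f(1) that by (simp add: inj_on_eq_iff)
    next
      case 2
      then show ?thesis using disj(2) by auto
    next
      case 3
      moreover have "f i \<in> f ` {..<m}" "g (j - Suc m) \<in> g ` {..<n}" using 3 that by auto
      then have "f i \<noteq> g (j - Suc m)" using disj(1) by (metis disjoint_iff)
      ultimately show ?thesis by simp
    next
      case 4
      have "g (j - Suc m) \<in> g ` {..<n}" using 4 that by auto
      then show ?thesis using disj(2) 4 that by auto
    next
      case 5
      have "g (i - Suc m) \<noteq> g (j - Suc m)"
        using g(1) 5 that by (subst inj_on_eq_iff) auto
      then show ?thesis using 5 that by simp
    qed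
  qed
  then have "inj_on ?h {..<m + n + 1}"
    by (intro linorder_inj_onI) auto
  moreover have "{?h i, ?h (Suc i)} \<in> E" if "Suc i < m + n + 1" for i
  proof -
    consider "Suc i < m" | "Suc i = m" | "i = m" | "m < i" by linarith
    then show ?thesis
    proof cases
      case 2
      then show ?thesis using w(1) by auto
    next
      case 3
      then show ?thesis using w(2) by (auto simp: insert_commute)
    next
      case 4
      then have "Suc i - Suc m = Suc (i - Suc m)" by simp
      with 4 show ?thesis using g(2)[of "i - Suc m"] that by auto
    qed (use f(2) in auto)
  qed
  ultimately show ?thesis unfolding has_copy_path_graph by blast
qed

lemma has_copy_cycle_closed:
  assumes f: "inj_on f {..<m}" "\<And>i. Suc i < m \<Longrightarrow> {f i, f (Suc i)} \<in> E"
    and w: "w \<notin> f ` {..<m}" "{f 0, w} \<in> E" "{f (m - 1), w} \<in> E"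
    and m: "m \<ge> 1"
  shows "has_copy (cycle_graph (Suc m)) E"
proof -
  let ?h = "\<lambda>i. if i < m then f i else w"
  have "inj_on ?h {..<Suc m}"
    using f(1) w(1) by (auto simp: inj_on_def)
  moreover have "?h ` e \<in> E" if e: "e \<in> edges (cycle_graph (Suc m))" for e
  proof -
    obtain i where i: "e = {i, Suc i mod Suc m}" "i < Suc m"
      using e unfolding cycle_graph_def by auto
    consider "Suc i < m" | "Suc i = m" | "i = m" using i(2) by linarith
    then show ?thesis
    proof cases
      case 1
      then show ?thesis using i f(2)[of i] by simp
    next
      case 2
      then have "?h ` e = {f (m - 1), w}" using i by auto
      then show ?thesis using w(3) by simp
    next
      case 3
      then have "?h ` e = {f 0, w}" using i m by auto
      then show ?thesis using w(2) by simp
    qed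
  qed
  moreover have "verts (cycle_graph (Suc m)) = {..<Suc m}" by (simp add: cycle_graph_def)
  ultimately show ?thesis unfolding has_copy_def by metis
qed

section \<open>Comparing the online Ramsey numbers\<close>

text \<open>
  By pigeonhole: of the \<open>2k\<close> new vertices fewer than \<open>k\<close> are red neighbours of \<open>x\<close> and fewer than
  \<open>k\<close> are red neighbours of \<open>y\<close>, or else there is a red star. The set \<open>A\<close> holds the vertices that
  the common neighbour has to avoid.
\<close>

lemma forces_common_blue_neighbour:
  assumes "finite A" "x \<in> A" "y \<in> A"
  shows "forces (\<lambda>R' B'. R \<subseteq> R' \<and> B \<subseteq> B' \<and>
            (has_copy (star_graph k) R' \<or> (\<exists>w. w \<notin> A \<and> {x, w} \<in> B' \<and> {y, w} \<in> B')))
          (4 * k) R B"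
proof -
  obtain W where W: "finite W" "card W = 2 * k" "W \<subseteq> - A"
    using infinite_arbitrarily_large[of "- A" "2 * k"] assms(1)
    by (auto simp: Compl_eq_Diff_UNIV)
  define F where "F = (\<lambda>w. {x, w}) ` W \<union> (\<lambda>w. {y, w}) ` W"
  have F: "finite F" "F \<subseteq> nsets UNIV 2"
    using W assms unfolding F_def by (auto simp: nsets_def card_insert_if)
  have "card F \<le> card W + card W"
    unfolding F_def by (rule order_trans[OF card_Un_le]) (intro add_mono card_image_le W(1))
  then have "card F \<le> 4 * k" using W(2) by simp
  have star: "has_copy (star_graph k) R'" if "u \<in> A" "k \<le> card {w\<in>W. {u, w} \<in> R'}" for u R'
  proof -
    obtain S where S: "S \<subseteq> {w\<in>W. {u, w} \<in> R'}" "card S = k"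
      using \<open>k \<le> card _\<close> by (meson obtain_subset_with_card_n)
    moreover have "finite S" by (rule finite_subset[OF S(1)]) (simp add: W(1))
    ultimately show ?thesis
      using W(3) \<open>u \<in> A\<close> by (intro has_copy_star_graph[of u S]) auto
  qed
  have "has_copy (star_graph k) R' \<or> (\<exists>w. w \<notin> A \<and> {x, w} \<in> B' \<and> {y, w} \<in> B')"
    if "F \<subseteq> R' \<union> B'" for R' B'
  proof (rule ccontr)
    assume neg: "\<not> ?thesis"
    then have less: "card {w\<in>W. {x, w} \<in> R'} < k" "card {w\<in>W. {y, w} \<in> R'} < k"
      using star[OF assms(2), of R'] star[OF assms(3), of R'] by (auto simp: not_less[symmetric])
    have "W \<subseteq> {w\<in>W. {x, w} \<in> R'} \<union> {w\<in>W. {y, w} \<in> R'}"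
    proof
      fix w assume "w \<in> W"
      then have "w \<notin> A" "{x, w} \<in> R' \<union> B'" "{y, w} \<in> R' \<union> B'"
        using W(3) that unfolding F_def by auto
      then show "w \<in> {w\<in>W. {x, w} \<in> R'} \<union> {w\<in>W. {y, w} \<in> R'}"
        using neg \<open>w \<in> W\<close> by auto
    qed
    then have "card W \<le> card ({w\<in>W. {x, w} \<in> R'} \<union> {w\<in>W. {y, w} \<in> R'})"
      using W(1) by (intro card_mono) auto
    also have "\<dots> \<le> card {w\<in>W. {x, w} \<in> R'} + card {w\<in>W. {y, w} \<in> R'}"
      by (rule card_Un_le)
    finally show False using less W(2) by simp
  qed
  then have "forces (\<lambda>R' B'. R \<subseteq> R' \<and> B \<subseteq> B' \<and>
      (has_copy (star_graph k) R' \<or> (\<exists>w. w \<notin> A \<and> {x, w} \<in> B' \<and> {y, w} \<in> B')))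
      (card F + 0) R B"
    by (intro forces_trans[OF forces_all_coloured[OF F, of R B]]) simp
  then show ?thesis
    by (rule forces_more_time) (use \<open>card F \<le> 4 * k\<close> in simp)
qed

text \<open>
  Builder plays for the second path on vertices beyond those of the first, and then links an end of
  one to an end of the other through a common blue neighbour, which is the extra vertex.
\<close>

lemma forces_path_joined:
  assumes s: "forces (goal (star_graph k) (path_graph m)) s {} {}"
    and t: "forces (goal (star_graph k) (path_graph n)) t {} {}"
    and "m \<ge> 1" "n \<ge> 1"
  shows "forces (goal (star_graph k) (path_graph (m + n + 1))) (s + (t + 4 * k)) {} {}"
    (is "forces ?Q _ _ _")
proof (rule forces_trans[OF s])
  fix R B assume *: "goal (star_graph k) (path_graph m) R B"
  show "forces ?Q (t + 4 * k) R B"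
  proof (cases "has_copy (star_graph k) R")
    case True
    then show ?thesis by (simp add: forces_done goal_def)
  next
    case False
    with * obtain f where f: "inj_on f {..<m}" "\<And>i. Suc i < m \<Longrightarrow> {f i, f (Suc i)} \<in> B"
      unfolding goal_def has_copy_path_graph by blast
    obtain N where N: "\<And>v. v \<in> f ` {..<m} \<Longrightarrow> v < N"
      by (metis finite_imageI finite_lessThan finite_nat_set_iff_bounded)
    define \<phi> where "\<phi> v = v + N" for v :: nat
    have \<phi>: "inj \<phi>" by (simp add: \<phi>_def inj_def)
    have second: "forces (\<lambda>R' B'. \<exists>R2 B2. R' = R \<union> (`) \<phi> ` R2 \<and> B' = B \<union> (`) \<phi> ` B2 \<and>
        goal (star_graph k) (path_graph n) R2 B2) t R B"
      using forces_relabelled[OF \<phi> t, of R B] by (simp only: image_empty Un_empty_right)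
    show ?thesis
    proof (rule forces_trans[OF second])
      fix R' B'
      assume "\<exists>R2 B2. R' = R \<union> (`) \<phi> ` R2 \<and> B' = B \<union> (`) \<phi> ` B2 \<and>
          goal (star_graph k) (path_graph n) R2 B2"
      then obtain R2 B2 where R': "R' = R \<union> (`) \<phi> ` R2" and B': "B' = B \<union> (`) \<phi> ` B2"
        and **: "goal (star_graph k) (path_graph n) R2 B2"
        by blast
      show "forces ?Q (4 * k) R' B'"
      proof (cases "has_copy (star_graph k) R2")
        case True
        then have "has_copy (star_graph k) R'"
          unfolding R' by (rule has_copy_mono[OF has_copy_relabelled[OF \<phi>]]) simp
        then show ?thesis by (simp add: forces_done goal_def)
      next
        case False
        with ** obtain g
          where g: "inj_on g {..<n}" "\<And>i. Suc i < n \<Longrightarrow> {g i, g (Suc i)} \<in> B2"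
          unfolding goal_def has_copy_path_graph by blast
        let ?g = "\<phi> \<circ> g" and ?A = "f ` {..<m} \<union> (\<phi> \<circ> g) ` {..<n}"
        have g': "inj_on ?g {..<n}"
          using g(1) \<phi> by (simp add: comp_inj_on inj_on_subset)
        have gE: "{?g i, ?g (Suc i)} \<in> B'" if "Suc i < n" for i
          using imageI[OF g(2)[OF that], of "(`) \<phi>"] by (simp add: B')
        have disj: "f ` {..<m} \<inter> ?g ` {..<n} = {}"
          using N by (fastforce simp: \<phi>_def)
        have "forces ?Q (4 * k + 0) R' B'"
        proof (rule forces_trans[OF forces_common_blue_neighbour[of ?A "f (m - 1)" "?g 0"]])
          fix R'' B''
          assume H: "R' \<subseteq> R'' \<and> B' \<subseteq> B'' \<and> (has_copy (star_graph k) R'' \<or>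
              (\<exists>w. w \<notin> ?A \<and> {f (m - 1), w} \<in> B'' \<and> {?g 0, w} \<in> B''))"
          show "forces ?Q 0 R'' B''"
          proof (cases "has_copy (star_graph k) R''")
            case True
            then show ?thesis by (simp add: goal_def)
          next
            case False
            with H obtain w
              where w: "w \<notin> ?A" "{f (m - 1), w} \<in> B''" "{?g 0, w} \<in> B''" by blast
            have "B \<subseteq> B''" "B' \<subseteq> B''" using H B' by auto
            then have "has_copy (path_graph (m + n + 1)) B''"
              using f(2) gE by (intro has_copy_path_joined[OF f(1) _ g' _ disj w]) auto
            then show ?thesis by (simp add: goal_def)
          qed
        qed (use assms(3,4) in auto)
        then show ?thesis by simp
      qed
    qed
  qed
qed

text \<open>
  The common blue neighbour of the two ends of the path is the last vertex of the cycle, so the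
  length of the cycle does not depend on Painter's choices.
\<close>

lemma forces_cycle_closed:
  assumes "forces (goal (star_graph k) (path_graph m)) t {} {}" and "m \<ge> 1"
  shows "forces (goal (star_graph k) (cycle_graph (Suc m))) (t + 4 * k) {} {}"
    (is "forces ?Q _ _ _")
proof (rule forces_trans[OF assms(1)])
  fix R B assume *: "goal (star_graph k) (path_graph m) R B"
  show "forces ?Q (4 * k) R B"
  proof (cases "has_copy (star_graph k) R")
    case True
    then show ?thesis by (simp add: forces_done goal_def)
  next
    case False
    with * obtain f where f: "inj_on f {..<m}" "\<And>i. Suc i < m \<Longrightarrow> {f i, f (Suc i)} \<in> B"
      unfolding goal_def has_copy_path_graph by blast
    have "forces ?Q (4 * k + 0) R B"
    proof (rule forces_trans[OF forces_common_blue_neighbour[of "f ` {..<m}" "f 0" "f (m - 1)"]])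
      fix R' B'
      assume H: "R \<subseteq> R' \<and> B \<subseteq> B' \<and> (has_copy (star_graph k) R' \<or>
          (\<exists>w. w \<notin> f ` {..<m} \<and> {f 0, w} \<in> B' \<and> {f (m - 1), w} \<in> B'))"
      show "forces ?Q 0 R' B'"
      proof (cases "has_copy (star_graph k) R'")
        case True
        then show ?thesis by (simp add: goal_def)
      next
        case False
        with H obtain w
          where w: "w \<notin> f ` {..<m}" "{f 0, w} \<in> B'" "{f (m - 1), w} \<in> B'" by blast
        then have "has_copy (cycle_graph (Suc m)) B'"
          using f(2) H assms(2) by (intro has_copy_cycle_closed[OF f(1) _ w]) auto
        then show ?thesis by (simp add: goal_def)
      qed
    qed (use assms(2) in auto)
    then show ?thesis by simp
  qed
qed

text \<open>
  Painter's counter-strategy is to answer blue as long as possible. Then no red edge ever appears, and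
  each round adds at most one blue edge, whereas a path on \<open>n\<close> vertices has \<open>n - 1\<close> edges. The case
  \<open>k = 0\<close> is excluded because a star without edges is there from the start.
\<close>

lemma forces_path_length_le:
  assumes "forces (goal (star_graph k) (path_graph n)) t {} B" "finite B" "k \<ge> 1"
  shows "n \<le> t + card B + 1"
proof -
  have base: "n \<le> card B + 1" if "goal (star_graph k) (path_graph n) {} B" "finite B" for B
  proof -
    have "edges (star_graph k) \<noteq> {}"
      using assms(3) unfolding star_graph_def by auto
    then have "\<not> has_copy (star_graph k) {}" unfolding has_copy_def by auto
    with that(1) have "has_copy (path_graph n) B" by (simp add: goal_def)
    then obtain f where f: "inj_on f {..<n}" "\<And>i. Suc i < n \<Longrightarrow> {f i, f (Suc i)} \<in> B"
      unfolding has_copy_path_graph by blast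
    have "inj_on (\<lambda>i. {f i, f (Suc i)}) {..<n - 1}"
    proof (rule inj_onI)
      fix i j assume ij: "i \<in> {..<n - 1}" "j \<in> {..<n - 1}" "{f i, f (Suc i)} = {f j, f (Suc j)}"
      have f_eq: "f u = f v \<longleftrightarrow> u = v" if "u < n" "v < n" for u v
        using that by (intro inj_on_eq_iff[OF f(1)]) auto
      have less: "i < n" "Suc i < n" "j < n" "Suc j < n" using ij(1,2) by auto
      from ij(3) consider "f i = f j" | "f i = f (Suc j)" "f (Suc i) = f j"
        unfolding doubleton_eq_iff by blast
      then show "i = j"
      proof cases
        case 1
        then show ?thesis using f_eq less by blast
      next
        case 2
        then have "i = Suc j" "Suc i = j" using f_eq less by blast+
        then show ?thesis by simp
      qed
    qed
    then have "n - 1 \<le> card B"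
      using card_inj_on_le[of "\<lambda>i. {f i, f (Suc i)}" "{..<n - 1}" B] f(2) that(2)
      by (simp add: image_subset_iff)
    then show ?thesis by simp
  qed
  show ?thesis
    using assms(1,2)
  proof (induction t arbitrary: B)
    case 0
    then show ?case using base by simp
  next
    case (Suc t)
    show ?case
    proof (cases "goal (star_graph k) (path_graph n) {} B")
      case True
      then show ?thesis using base[of B] Suc.prems(2) by simp
    next
      case False
      then obtain e where "forces (goal (star_graph k) (path_graph n)) t {} (insert e B)"
        using Suc.prems(1) unfolding forces.simps(2) by blast
      then have "n \<le> t + card (insert e B) + 1" using Suc.prems(2) by (intro Suc.IH) simp_all
      also have "\<dots> \<le> Suc t + card B + 1" using Suc.prems(2) by (simp add: card_insert_if)
      finally show ?thesis .
    qed
  qed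
qed

section \<open>Subadditive sequences\<close>

text \<open>
  Fekete's lemma; the limit is the infimum of the quotients. For \<open>m\<close> whose quotient is close to the
  infimum and \<open>n = q m + r\<close>, subadditivity gives \<open>f n \<le> q f m + f r\<close>, and the remainder
  term is bounded.
\<close>

lemma subadditive_quotient_tendsto:
  fixes f :: "nat \<Rightarrow> real"
  assumes sub: "\<And>m n. m \<ge> 1 \<Longrightarrow> n \<ge> 1 \<Longrightarrow> f (m + n) \<le> f m + f n"
    and lower: "\<And>n. n \<ge> 1 \<Longrightarrow> c * real n \<le> f n" and "c \<ge> 0"
  shows "\<exists>L\<ge>c. (\<lambda>n. f n / real n) \<longlonglongrightarrow> L"
proof -
  define L where "L = (INF n\<in>{1..}. f n / real n)"
  have cL: "c \<le> f n / real n" if "n \<ge> 1" for n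
    using lower[OF that] that by (simp add: field_simps)
  have bdd: "bdd_below ((\<lambda>n. f n / real n) ` {1..})"
    using cL by (auto intro!: bdd_belowI2)
  have Lle: "L \<le> f n / real n" if "n \<ge> 1" for n
    unfolding L_def using bdd that by (auto intro: cINF_lower)
  have f_nonneg: "0 \<le> f n" if "n \<ge> 1" for n
    using lower[OF that] \<open>c \<ge> 0\<close> by (meson mult_nonneg_nonneg of_nat_0_le_iff order_trans)
  have "(\<lambda>n. f n / real n) \<longlonglongrightarrow> L"
  proof (rule order_tendstoI)
    fix a assume "a < L"
    then show "\<forall>\<^sub>F n in sequentially. a < f n / real n"
      using Lle by (intro eventually_mono[OF eventually_ge_at_top[of 1]]) (rule less_le_trans)
  next
    fix a assume "L < a"
    then obtain m where m: "m \<ge> 1" "f m / real m < a"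
      unfolding L_def using bdd by (auto simp: cINF_less_iff)
    define M where "M = Max (f ` {1..m})"
    have mult: "f (q * m + r) \<le> real q * f m + f r" if "r \<ge> 1" for q r
    proof (induction q)
      case (Suc q)
      have "f (m + (q * m + r)) \<le> f m + f (q * m + r)"
        using m(1) that by (intro sub) auto
      with Suc show ?case by (simp add: algebra_simps)
    qed simp
    have upper: "f n / real n \<le> f m / real m + M / real n" if "n \<ge> 1" for n
    proof -
      \<comment> \<open>Division with remainder in \<open>1..m\<close> instead of \<open>0..<m\<close>, since subadditivity is available
        for positive arguments only.\<close>
      define q r where "q = (n - 1) div m" and "r = Suc ((n - 1) mod m)"
      have r: "1 \<le> r" "r \<le> m" using m(1) by (auto simp: r_def Suc_le_eq)
      have n: "n = q * m + r"
        using that by (simp add: q_def r_def)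
      have "f r \<le> M" unfolding M_def using r by (intro Max_ge) auto
      then have "f n \<le> real q * f m + M" using mult[OF r(1), of q] n by simp
      moreover have "real q * f m = real (q * m) * (f m / real m)" using m(1) by simp
      moreover have "\<dots> \<le> real n * (f m / real m)"
        using n f_nonneg[OF m(1)] by (intro mult_right_mono) (auto simp del: of_nat_mult)
      ultimately have "f n \<le> real n * (f m / real m) + M" by linarith
      then show ?thesis using that by (simp add: field_simps)
    qed
    have "(\<lambda>n. f m / real m + M / real n) \<longlonglongrightarrow> f m / real m + 0"
      by (intro tendsto_intros lim_const_over_n)
    then have "\<forall>\<^sub>F n in sequentially. f m / real m + M / real n < a"
      using m(2) by (auto dest: order_tendstoD(2))
    then show "\<forall>\<^sub>F n in sequentially. f n / real n < a"
      using eventually_ge_at_top[of 1] by eventually_elim (use upper in force)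
  qed
  moreover have "c \<le> L"
    unfolding L_def using cL by (intro cINF_greatest) auto
  ultimately show ?thesis by blast
qed

section \<open>The common limit\<close>

theorem theorem1p6:
  fixes k :: nat
  assumes "k \<ge> 1"
  shows "\<exists>L::real. L > 0 \<and>
    (\<lambda>n. real (online_ramsey (star_graph k) (path_graph n)) / real n) \<longlonglongrightarrow> L \<and>
    (\<lambda>n. real (online_ramsey (star_graph k) (cycle_graph n)) / real n) \<longlonglongrightarrow> L"
proof -
  define r where "r n = online_ramsey (star_graph k) (path_graph n)" for n
  define c where "c n = online_ramsey (star_graph k) (cycle_graph n)" for n
  let ?P = "\<lambda>n t. forces (goal (star_graph k) (path_graph n)) t {} {}"
  let ?C = "\<lambda>n t. forces (goal (star_graph k) (cycle_graph n)) t {} {}"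

  have P_shorter: "?P m t" if "?P n t" "m \<le> n" for m n t
  proof -
    have "?P m (t + 0)"
      by (rule forces_trans[OF that(1)])
        (use that(2) in \<open>auto simp: goal_def intro: has_copy_path_shorter\<close>)
    then show ?thesis by simp
  qed
  have P1: "?P 1 0"
    by (auto simp: goal_def has_copy_path_graph)
  have "\<exists>t. ?P n t" for n
  proof -
    have "\<exists>t. ?P (Suc n) t"
    proof (induction n)
      case 0
      show ?case using P1 by (intro exI[of _ 0]) (simp only: One_nat_def)
    next
      case (Suc n)
      then obtain t where "?P (Suc n) t" by blast
      from forces_path_joined[OF this P1] have "?P (Suc n + 1 + 1) (t + (0 + 4 * k))" by simp
      from P_shorter[OF this, of "Suc (Suc n)"] show ?case by auto
    qed
    then obtain t where "?P (Suc n) t" by blast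
    from P_shorter[OF this, of n] show ?thesis by auto
  qed
  then have P: "?P n (r n)" for n
    unfolding r_def using forces_online_ramsey by blast
  have r_le: "r n \<le> t" if "?P n t" for n t
    unfolding r_def using that by (rule online_ramsey_le)
  have r_mono: "r m \<le> r n" if "m \<le> n" for m n
    using P_shorter[OF P that] by (rule r_le)
  have r_joined: "r (m + n + 1) \<le> r m + r n + 4 * k" if "m \<ge> 1" "n \<ge> 1" for m n
    using r_le[OF forces_path_joined[OF P P that]] by simp
  have r_ge: "n \<le> r n + 1" for n
    using forces_path_length_le[OF P _ assms, of n] by simp

  have C: "?C (Suc n) (r n + 4 * k)" if "n \<ge> 1" for n
    using forces_cycle_closed[OF P that] .
  have c_le: "c (Suc n) \<le> r n + 4 * k" if "n \<ge> 1" for n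
    unfolding c_def by (rule online_ramsey_le[OF C[OF that]])
  have r_le_c: "r (Suc n) \<le> c (Suc n)" if "n \<ge> 1" for n
  proof -
    have "?C (Suc n) (c (Suc n))"
      unfolding c_def using C[OF that] by (rule forces_online_ramsey)
    then have "?P (Suc n) (c (Suc n) + 0)"
      by (rule forces_trans) (auto simp: goal_def intro: has_copy_cycle_imp_path)
    then show ?thesis using r_le by simp
  qed

  \<comment> \<open>The shift of the argument absorbs the extra vertex of a joined path, the summand \<open>4 * k\<close>
    the cost of joining.\<close>
  define f where "f n = real (r (n - 1) + 4 * k)" for n
  have "f (m + n) \<le> f m + f n" if mn: "m \<ge> 1" "n \<ge> 1" for m n
  proof -
    \<comment> \<open>An argument \<open>1\<close> of \<open>f\<close> stands for the path without vertices, which has no end to join. The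
      bound \<open>r n \<le> r (n - 1) + 4 * k\<close> needed here comes from joining a single vertex instead.\<close>
    have one: "f (1 + n) \<le> f 1 + f n" if n: "n \<ge> 1" for n
    proof -
      consider "n = 1" | "n \<ge> 2" using n by linarith
      then show ?thesis
      proof cases
        case 1
        have "r 1 = 0" using r_le[OF P1] by simp
        then show ?thesis using 1 by (simp add: f_def)
      next
        case 2
        have "r n \<le> r (n - 1 + 1 + 1)" by (intro r_mono) simp
        also have "\<dots> \<le> r (n - 1) + r 1 + 4 * k" using 2 by (intro r_joined) auto
        finally show ?thesis using r_le[OF P1] by (simp add: f_def)
      qed
    qed
    consider "m = 1" | "n = 1" | "m \<ge> 2" "n \<ge> 2" using mn by linarith
    then show ?thesis
    proof cases
      case 1
      then show ?thesis using one mn by simp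
    next
      case 2
      then show ?thesis using one[of m] mn by (simp add: add.commute)
    next
      case 3
      then have "m + n - 1 = m - 1 + (n - 1) + 1" by simp
      moreover have "r (m - 1 + (n - 1) + 1) \<le> r (m - 1) + r (n - 1) + 4 * k"
        using 3 by (intro r_joined) auto
      ultimately have "r (m + n - 1) \<le> r (m - 1) + r (n - 1) + 4 * k" by (simp only:)
      then show ?thesis by (simp add: f_def)
    qed
  qed
  moreover have "1 * real n \<le> f n" for n
    using r_ge[of "n - 1"] assms unfolding f_def by linarith
  ultimately obtain L where "L \<ge> 1" and f_lim: "(\<lambda>n. f n / real n) \<longlonglongrightarrow> L"
    using subadditive_quotient_tendsto[of f 1] by auto

  have "(\<lambda>n. f n / real n - 4 * real k / real n) \<longlonglongrightarrow> L - 0"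
    by (intro tendsto_diff f_lim lim_const_over_n)
  then have lower_lim: "(\<lambda>n. f n / real n - 4 * real k / real n) \<longlonglongrightarrow> L" by simp
  have sandwich: "f n - 4 * real k \<le> real (r n) \<and> r n \<le> c n \<and> real (c n) \<le> f n" if n: "n \<ge> 2" for n
  proof -
    obtain n' where n': "n = Suc n'" "n' \<ge> 1" using n by (cases n) auto
    show ?thesis
      using r_mono[of n' n] r_le_c[OF n'(2)] c_le[OF n'(2)] n'(1) unfolding f_def by simp
  qed
  have squeeze: "(\<lambda>n. real (a n) / real n) \<longlonglongrightarrow> L"
    if "\<And>n. n \<ge> 2 \<Longrightarrow> r n \<le> a n \<and> a n \<le> c n" for a
  proof (rule tendsto_sandwich[OF _ _ lower_lim f_lim])
    show "\<forall>\<^sub>F n in sequentially. f n / real n - 4 * real k / real n \<le> real (a n) / real n"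
      using eventually_ge_at_top[of 2]
    proof eventually_elim
      case (elim n)
      then have "f n - 4 * real k \<le> real (a n)" using sandwich[of n] that[of n] by simp
      then show ?case by (simp add: divide_right_mono flip: diff_divide_distrib)
    qed
    show "\<forall>\<^sub>F n in sequentially. real (a n) / real n \<le> f n / real n"
      using eventually_ge_at_top[of 2]
    proof eventually_elim
      case (elim n)
      then have "real (a n) \<le> f n" using sandwich[of n] that[of n] by simp
      then show ?case by (simp add: divide_right_mono)
    qed
  qed
  have "(\<lambda>n. real (r n) / real n) \<longlonglongrightarrow> L" "(\<lambda>n. real (c n) / real n) \<longlonglongrightarrow> L"
    using sandwich by (auto intro!: squeeze)
  then show ?thesis using \<open>L \<ge> 1\<close> unfolding r_def c_def by (intro exI[of _ L]) auto
qed

end
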